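(* Let $\sigma$ be the real number with continued fraction expansion $\sigma=[s_0,s_1,s_2,\ldots]=[1,2,1,4,1,2,1,8,\ldots]$, where $s_i=2^{\nu_2(i+1)}$ for all $i\ge 0$. Then the irrationality measure of $\sigma^2$ is at least $8/3$.
   Context: For an integer $x\neq 0$, $\nu_2(x)$ denotes the exponent of the largest power of $2$ dividing $x$. The notation $[a_0,a_1,a_2,\ldots]$ denotes the infinite simple continued fraction $a_0+\cfrac{1}{a_1+\cfrac{1}{a_2+\cdots}}$ with positive integer partial quotients. The irrationality measure of a real number $x$ is the infimum of all real $\mu$ such that the inequality $|x-p/q|<q^{-\mu}$ has at most finitely many solutions in integer pairs $(p,q)$ with $q\ge 1$. *)

theory Defs
  imports Complex_Main "HOL-Computational_Algebra.Computational_Algebra" "HOL-Library.Extended_Real"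
begin

primrec cfrac_conv :: "(nat \<Rightarrow> nat) \<Rightarrow> nat \<Rightarrow> real" where
  "cfrac_conv a 0 = real (a 0)"
| "cfrac_conv a (Suc n) = real (a 0) + 1 / cfrac_conv (\<lambda>i. a (Suc i)) n"

text \<open>Only meaningful for positive partial quotients, for which the convergents do converge.\<close>

definition cfrac_value :: "(nat \<Rightarrow> nat) \<Rightarrow> real" where
  "cfrac_value a = lim (cfrac_conv a)"

definition sigma_quot :: "nat \<Rightarrow> nat" where
  "sigma_quot i = 2 ^ multiplicity 2 (i + 1)"

definition sigma :: real where
  "sigma = cfrac_value sigma_quot"

text \<open>The infimum is taken in the extended reals, so that the measure of a number admitting no
  such exponent is \<open>\<infinity>\<close>. Pairs \<open>(p, q)\<close> need not be coprime.\<close>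

definition irrationality_measure :: "real \<Rightarrow> ereal" where
  "irrationality_measure x =
     Inf (ereal ` {\<mu> :: real. finite {(p :: int, q :: int).
            q \<ge> 1 \<and> \<bar>x - of_int p / of_int q\<bar> < of_int q powr (- \<mu>)}})"

end

theory Submission
  imports Defs "HOL-Real_Asymp.Real_Asymp"
begin

text \<open>Let \<open>n = 2 ^ (m + 1)\<close>. The word \<open>W = s\<^sub>0 \<dots> s\<^bsub>n - 2\<^esub>\<close> is a palindrome, hence has a symmetric
  continuant matrix with rows \<open>(x, y)\<close> and \<open>(y, w)\<close>, and the quotients start with the palindrome
  \<open>W n W\<close>, with matrix rows \<open>(a, b)\<close> and \<open>(b, c)\<close>. Both \<open>a/b\<close> and \<open>b/c\<close> are convergents of
  \<open>\<sigma>\<close>, so \<open>a/c\<close> is close to \<open>\<sigma>\<^sup>2\<close>. With \<open>u = n x + 2 y\<close> and \<open>v = n y + 2 w\<close> one has \<open>a = x u\<close>,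
  \<open>b = y u - 1\<close>, \<open>c = y v\<close>, and these factorisations yield a far better fraction \<open>p/q\<close> near \<open>a/c\<close>,
  namely \<open>p = x (n a + b)\<close> and \<open>q = b (n y + w)\<close>, for which \<open>q a - p c = n x\<close>.
  Up to powers of \<open>n\<close>, which is logarithmic in \<open>b\<close>, we have \<open>q \<approx> b ^ (3/2)\<close>, while the next
  partial quotient \<open>2 n\<close> and the repetition of the palindrome make the error as small as \<open>b ^ (-4)\<close>;
  this is the exponent \<open>8/3\<close>.\<close>

section \<open>Finite continued fractions with a real last entry\<close>

text \<open>The argument \<open>y\<close> plays the role of the complete quotient after
  \<open>k\<close> entries, so that truncations of every length become values of one Moebius map in
  \<open>y\<close>.\<close>

primrec cfrac_tail :: "(nat \<Rightarrow> nat) \<Rightarrow> nat \<Rightarrow> real \<Rightarrow> real" where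
  "cfrac_tail s 0 y = y"
| "cfrac_tail s (Suc k) y = real (s 0) + 1 / cfrac_tail (\<lambda>i. s (Suc i)) k y"

lemma cfrac_tail_add:
  "cfrac_tail s (j + k) y = cfrac_tail s j (cfrac_tail (\<lambda>i. s (i + j)) k y)"
  by (induction j arbitrary: s) simp_all

lemma cfrac_conv_eq_tail:
  "cfrac_conv s (k + m) = cfrac_tail s k (cfrac_conv (\<lambda>i. s (i + k)) m)"
  by (induction k arbitrary: s) simp_all

lemma cfrac_tail_cong:
  "(\<And>i. i < k \<Longrightarrow> s i = s' i) \<Longrightarrow> cfrac_tail s k y = cfrac_tail s' k y"
proof (induction k arbitrary: s s')
  case (Suc k)
  have "cfrac_tail (\<lambda>i. s (Suc i)) k y = cfrac_tail (\<lambda>i. s' (Suc i)) k y"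
    by (rule Suc.IH) (simp add: Suc.prems)
  then show ?case by (simp add: Suc.prems)
qed simp

lemma cfrac_conv_ge:
  "real (s 0) \<le> cfrac_conv s m"
proof -
  have "0 \<le> cfrac_conv s m" for s m
    by (induction m arbitrary: s) simp_all
  then show ?thesis by (cases m) simp_all
qed

section \<open>Self-similarity of the quotients and their palindromic prefixes\<close>

lemma sigma_quot_pred_power: "sigma_quot (2 ^ n - 1) = 2 ^ n"
  by (simp add: sigma_quot_def)

text \<open>As \<open>i + 1 < 2 ^ n\<close>, its 2-adic valuation is below \<open>n\<close>, and
  adding a number of larger valuation does not change it.\<close>

lemma sigma_quot_add_power:
  assumes "i < 2 ^ n - 1"
  shows "sigma_quot (i + 2 ^ n) = sigma_quot i"
proof -
  let ?v = "multiplicity 2 (i + 1)"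
  have "2 ^ ?v dvd i + 1" by (rule multiplicity_dvd)
  then have "(2::nat) ^ ?v \<le> i + 1" by (rule dvd_imp_le) simp
  then have "(2::nat) ^ ?v < 2 ^ n" using assms by linarith
  then have "?v < n" by simp
  moreover have "multiplicity 2 ((2::nat) ^ n) = n" by simp
  ultimately have "multiplicity 2 ((i + 1) + 2 ^ n) = ?v"
    by (intro multiplicity_sum_lt) auto
  then show ?thesis by (simp add: sigma_quot_def add.commute add.left_commute)
qed

text \<open>The first \<open>2 ^ (m + 1) - 1\<close> partial quotients form a palindrome, so the product of their
  matrices is symmetric; \<open>pal m = (a, b, c)\<close> stands for the matrix with rows \<open>(a, b)\<close> and
  \<open>(b, c)\<close>.\<close>

primrec pal :: "nat \<Rightarrow> int \<times> int \<times> int" where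
  "pal 0 = (1, 1, 0)"
| "pal (Suc m) = (case pal m of (a, b, c) \<Rightarrow>
     let u = 2 ^ Suc m * a + 2 * b; v = 2 ^ Suc m * b + 2 * c in (a * u, b * u - 1, b * v))"

text \<open>The word has odd length, so the determinant is -1. The \<open>+ 1\<close> in
  \<open>a + 1 \<le> 2 * b\<close> compensates the \<open>- 1\<close> in the recursion for
  \<open>b\<close>; without it the bound would not be inductive.\<close>

lemma pal_invariants:
  assumes "pal m = (a, b, c)"
  shows "a * c = b\<^sup>2 - 1" "b \<le> a" "a + 1 \<le> 2 * b" "0 \<le> c" "c \<le> b" "1 \<le> b"
    "2 ^ (2 ^ m - 1) \<le> b"
proof -
  have "a * c = b\<^sup>2 - 1 \<and> b \<le> a \<and> a + 1 \<le> 2 * b \<and> 0 \<le> c \<and> c \<le> b \<and> 1 \<le> b \<and> 2 ^ (2 ^ m - 1) \<le> b"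
    using assms
  proof (induction m arbitrary: a b c)
    case (Suc m)
    obtain x y z where xyz: "pal m = (x, y, z)" by (metis prod.exhaust)
    define t :: int where "t = 2 ^ Suc m"
    define u where "u = t * x + 2 * y"
    define v where "v = t * y + 2 * z"
    have abc: "a = x * u" "b = y * u - 1" "c = y * v"
      using Suc.prems xyz by (simp_all add: Let_def u_def v_def t_def)
    have IH: "x * z = y\<^sup>2 - 1" "y \<le> x" "x + 1 \<le> 2 * y" "0 \<le> z" "z \<le> y" "1 \<le> y"
       "2 ^ (2 ^ m - 1) \<le> y"
      using Suc.IH[OF xyz] by auto
    have t: "2 \<le> t" unfolding t_def by simp
    have "2 * 1 \<le> t * x" by (rule mult_mono) (use t IH in auto)
    then have u: "4 \<le> u" unfolding u_def using IH by linarith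
    have "0 \<le> t * y" using t IH by simp
    then have v: "0 \<le> v" unfolding v_def using IH by linarith
    have yu: "y * u = x * v + 2"
      unfolding u_def v_def using IH(1) by (simp add: algebra_simps power2_eq_square)
    have 1: "a * c = b\<^sup>2 - 1"
    proof -
      have "a * c = (y * u) * (x * v)" by (simp add: abc)
      also have "\<dots> = (b + 1) * (b - 1)" using yu by (simp add: abc)
      finally show ?thesis by (simp add: algebra_simps power2_eq_square)
    qed
    have 2: "b \<le> a" unfolding abc using mult_right_mono[OF IH(2), of u] u by linarith
    have 3: "a + 1 \<le> 2 * b" unfolding abc using mult_right_mono[OF IH(3), of u] u
      by (simp add: algebra_simps)
    have 4: "0 \<le> c" unfolding abc using v IH by simp
    have 5: "c \<le> b" unfolding abc yu using mult_right_mono[OF IH(2), of v] v by linarith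
    have "2 * (y * y) \<le> t * (x * y)" using t IH by (intro mult_mono) auto
    moreover have "y * u = t * (x * y) + 2 * (y * y)" by (simp add: u_def algebra_simps)
    moreover have yy: "1 * 1 \<le> y * y" using IH by (intro mult_mono) auto
    ultimately have 6: "2 * (y * y) \<le> b" unfolding abc by linarith
    \<comment> \<open>The exponent doubles and gains one, exactly as squaring and doubling do in
      \<open>2 * (y * y) \<le> b\<close>.\<close>
    have e: "2 ^ Suc m - 1 = Suc ((2 ^ m - 1) + (2 ^ m - 1))"
      by (cases "(2::nat) ^ m") auto
    have "(2::int) ^ (2 ^ Suc m - 1) = 2 * (2 ^ (2 ^ m - 1) * 2 ^ (2 ^ m - 1))"
      unfolding e by (simp only: power_Suc power_add)
    also have "\<dots> \<le> 2 * (y * y)" using IH by (intro mult_mono) auto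
    finally have 7: "2 ^ (2 ^ Suc m - 1) \<le> b" using 6 by linarith
    have "1 \<le> b" using 6 yy by linarith
    then show ?case using 1 2 3 4 5 7 by blast
  qed auto
  then show "a * c = b\<^sup>2 - 1" "b \<le> a" "a + 1 \<le> 2 * b" "0 \<le> c" "c \<le> b" "1 \<le> b"
    "2 ^ (2 ^ m - 1) \<le> b" by blast+
qed

section \<open>Palindromic prefixes as Moebius maps\<close>

text \<open>The middle quotient is \<open>2 ^ n\<close>, and after it the first
  \<open>2 ^ n - 1\<close> quotients repeat.\<close>

lemma cfrac_tail_double:
  "cfrac_tail sigma_quot (2 ^ Suc n - 1) y =
    cfrac_tail sigma_quot (2 ^ n - 1) (2 ^ n + 1 / cfrac_tail sigma_quot (2 ^ n - 1) y)"
proof -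
  define k :: nat where "k = 2 ^ n - 1"
  have k: "Suc k = 2 ^ n" unfolding k_def by simp
  have l: "2 ^ Suc n - 1 = k + Suc k" using k by simp
  have shift: "Suc (i + k) = i + 2 ^ n" for i using k by simp
  have "cfrac_tail (\<lambda>i. sigma_quot (i + 2 ^ n)) k y = cfrac_tail sigma_quot k y"
    by (rule cfrac_tail_cong) (simp add: sigma_quot_add_power k_def)
  then show ?thesis
    using sigma_quot_pred_power[of n]
    unfolding l k_def[symmetric] cfrac_tail_add by (simp add: shift)
qed

text \<open>Doubling composes the map \<open>f\<close> of the half word with itself as
  \<open>f (t + 1 / f y)\<close>. Hence \<open>y\<close> is generalized in the induction: the
  hypothesis is applied at two arguments.\<close>

lemma cfrac_tail_pal:
  assumes "pal m = (a, b, c)" "0 < y"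
  shows "cfrac_tail sigma_quot (2 ^ Suc m - 1) y = (a * y + b) / (b * y + c)"
  using assms
proof (induction m arbitrary: a b c y)
  case 0
  have "sigma_quot 0 = 1" using sigma_quot_pred_power[of 0] by simp
  then show ?case using 0 by (auto simp: divide_simps add.commute)
next
  case (Suc m)
  obtain x z w where xzw: "pal m = (x, z, w)" by (metis prod.exhaust)
  define t :: int where "t = 2 ^ Suc m"
  have abc: "a = x * (t * x + 2 * z)" "b = z * (t * x + 2 * z) - 1" "c = z * (t * z + 2 * w)"
    using Suc.prems xzw by (simp_all add: Let_def t_def)
  note inv = pal_invariants[OF xzw]
  have pos: "0 < real_of_int x" "0 < real_of_int z" "0 \<le> real_of_int w" using inv by auto
  have t: "0 < real_of_int t" by (simp add: t_def)
  define f where "f = (\<lambda>y::real. (x * y + z) / (z * y + w))"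
  have num: "0 < x * y + z" "0 < z * y + w" if "0 < y" for y :: real
    using that pos by (auto intro!: add_pos_pos add_pos_nonneg)
  have fpos: "0 < f y" if "0 < y" for y using num[OF that] by (simp add: f_def)
  have "cfrac_tail sigma_quot (2 ^ Suc (Suc m) - 1) y = f (t + 1 / f y)"
  proof -
    have IH: "cfrac_tail sigma_quot (2 ^ Suc m - 1) y = f y" if "0 < y" for y
      unfolding f_def by (rule Suc.IH[OF xzw that])
    have "real_of_int t = 2 ^ Suc m" by (simp add: t_def)
    moreover have "0 < t + 1 / f y" using t fpos[OF Suc.prems(2)] by (simp add: add_pos_pos)
    ultimately show ?thesis
      unfolding cfrac_tail_double[of "Suc m"] IH[OF Suc.prems(2)] by (metis IH)
  qed
  also have "\<dots> = (x * (t * (x * y + z) + (z * y + w)) + z * (x * y + z)) /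
                  (z * (t * (x * y + z) + (z * y + w)) + w * (x * y + z))"
  proof -
    have "t + 1 / f y = (t * (x * y + z) + (z * y + w)) / (x * y + z)"
      using num[OF \<open>0 < y\<close>] by (simp add: f_def field_simps)
    moreover have "(x * (A / B) + z) / (z * (A / B) + w) = (x * A + z * B) / (z * A + w * B)"
      if "B > 0" for A B :: real
    proof -
      have "x * (A / B) + z = (x * A + z * B) / B" "z * (A / B) + w = (z * A + w * B) / B"
        using that by (simp_all add: field_simps)
      then show ?thesis using that by simp
    qed
    ultimately show ?thesis using num[OF \<open>0 < y\<close>] by (simp add: f_def)
  qed
  \<comment> \<open>The product contains \<open>x * w + z\<^sup>2\<close>; the determinant makes it
    \<open>2 * z\<^sup>2 - 1\<close>, whence the \<open>- 1\<close> in \<open>b\<close>.\<close>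
  also have "x * (t * (x * y + z) + (z * y + w)) + z * (x * y + z) = a * y + b"
  proof -
    have "real_of_int (x * w) = real_of_int (z\<^sup>2 - 1)" using inv(1) by simp
    then show ?thesis by (simp add: abc algebra_simps power2_eq_square)
  qed
  also have "z * (t * (x * y + z) + (z * y + w)) + w * (x * y + z) = b * y + c"
  proof -
    have "real_of_int (x * w) = real_of_int (z\<^sup>2 - 1)" using inv(1) by simp
    then have "x * (w * y) = (z\<^sup>2 - 1) * y" by (simp add: mult.assoc[symmetric])
    then show ?thesis by (simp add: abc algebra_simps power2_eq_square)
  qed
  finally show ?case .
qed

section \<open>Convergence of the continued fraction\<close>

text \<open>The remaining quotients fold into one complete quotient, which is at least its leading
  entry \<open>2 ^ n\<close>.\<close>

lemma cfrac_conv_sigma_quot_tail: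
  assumes "2 ^ n - 1 \<le> k"
  obtains y where "1 \<le> y" "2 ^ n \<le> y"
    "cfrac_conv sigma_quot k = cfrac_tail sigma_quot (2 ^ n - 1) y"
proof -
  let ?l = "2 ^ n - 1 :: nat"
  define y where "y = cfrac_conv (\<lambda>i. sigma_quot (i + ?l)) (k - ?l)"
  have "real (sigma_quot (0 + ?l)) \<le> y" unfolding y_def by (rule cfrac_conv_ge)
  then have y: "2 ^ n \<le> y" using sigma_quot_pred_power[of n] by simp
  have "cfrac_conv sigma_quot k = cfrac_tail sigma_quot ?l y"
    using cfrac_conv_eq_tail[of sigma_quot ?l "k - ?l"] assms by (simp add: y_def)
  moreover have "1 \<le> y" using y one_le_power[of "2::real" n] by linarith
  ultimately show ?thesis using that y by blast
qed

text \<open>Since \<open>sigma\<close> is defined by \<open>lim\<close>, it carries information only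
  once the convergents are known to be Cauchy.\<close>

lemma cfrac_conv_sigma_quot_LIMSEQ: "cfrac_conv sigma_quot \<longlonglongrightarrow> sigma"
proof -
  have "Cauchy (cfrac_conv sigma_quot)"
  proof (rule metric_CauchyI)
    fix e :: real assume "0 < e"
    have "(\<lambda>m. 2 / 2 ^ m :: real) \<longlonglongrightarrow> 0" by real_asymp
    then have "eventually (\<lambda>m. 2 / 2 ^ m < e) sequentially"
      using \<open>0 < e\<close> by (rule order_tendstoD)
    then obtain m where m: "2 / 2 ^ m < e" by (auto simp: eventually_sequentially)
    obtain a b c where abc: "pal m = (a, b, c)" by (metis prod.exhaust)
    note inv = pal_invariants[OF abc]
    \<comment> \<open>\<open>a / b\<close> is the value of the Moebius map at infinity, and the
      determinant makes the difference exactly \<open>1 / (b * (b * z + c))\<close>.\<close>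
    have close: "\<bar>cfrac_conv sigma_quot k - a / b\<bar> < 1 / 2 ^ m" if k: "2 ^ Suc m - 1 \<le> k" for k
    proof -
      obtain z where z1: "1 \<le> z" and z2: "2 ^ Suc m \<le> z"
        and "cfrac_conv sigma_quot k = cfrac_tail sigma_quot (2 ^ Suc m - 1) z"
        by (rule cfrac_conv_sigma_quot_tail[OF k])
      then have z: "cfrac_conv sigma_quot k = (a * z + b) / (b * z + c)"
        using cfrac_tail_pal[OF abc, of z] by simp
      have b: "1 \<le> real_of_int b" "0 \<le> real_of_int c" using inv(4,6) by simp_all
      have zpos: "0 < z" using z1 by linarith
      have "1 * z \<le> b * z" using b zpos by (intro mult_right_mono) auto
      then have "2 ^ Suc m \<le> b * z + c" using z2 b by linarith
      moreover have "2 ^ m < (2::real) ^ Suc m" by simp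
      ultimately have den: "2 ^ m < b * z + c" by linarith
      have "(0::real) < 2 ^ m" by simp
      then have den0: "0 < b * z + c" using den by linarith
      have "real_of_int (a * c) = real_of_int (b\<^sup>2 - 1)" using inv(1) by simp
      then have "(a * z + b) * b - a * (b * z + c) = 1"
        by (simp add: algebra_simps power2_eq_square)
      then have "cfrac_conv sigma_quot k - a / b = 1 / (b * (b * z + c))"
        unfolding z using b den0 by (subst diff_frac_eq) (simp_all add: mult.commute)
      then have "\<bar>cfrac_conv sigma_quot k - a / b\<bar> = 1 / (b * (b * z + c))"
        using b den0 by simp
      also have "\<dots> < 1 / 2 ^ m"
      proof (rule divide_strict_left_mono)
        have "1 * (b * z + c) \<le> b * (b * z + c)" using b den0 by (intro mult_right_mono) auto
        then show "2 ^ m < b * (b * z + c)" using den by (simp only: mult_1)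
      qed (use b den0 in auto)
      finally show ?thesis .
    qed
    have "dist (cfrac_conv sigma_quot i) (cfrac_conv sigma_quot j) < e"
      if "2 ^ Suc m - 1 \<le> i" "2 ^ Suc m - 1 \<le> j" for i j
      using close[OF that(1)] close[OF that(2)] m by (simp add: dist_real_def abs_less_iff)
    then show "\<exists>M. \<forall>i\<ge>M. \<forall>j\<ge>M. dist (cfrac_conv sigma_quot i) (cfrac_conv sigma_quot j) < e"
      by blast
  qed
  then show ?thesis
    unfolding sigma_def cfrac_value_def
    by (simp add: Cauchy_convergent convergent_LIMSEQ_iff[symmetric])
qed

section \<open>Algebraic identities for the approximating fraction\<close>

context
  fixes x y w t u v a b c p q :: real
  assumes det: "x * w = y\<^sup>2 - 1"
  defines "u \<equiv> t * x + 2 * y" and "v \<equiv> t * y + 2 * w"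
  defines "a \<equiv> x * u" and "b \<equiv> y * u - 1" and "c \<equiv> y * v"
  defines "p \<equiv> x * (t * a + b)" and "q \<equiv> b * (t * y + w)"
begin

text \<open>The two sides of the first identity differ by a multiple of the determinant relation. It
  yields \<open>y * u = b + 1\<close> and \<open>x * v = b - 1\<close>, whose product is
  \<open>a * c\<close>.\<close>

lemma double_det: "y * u = x * v + 2" "a * c = b\<^sup>2 - 1"
proof -
  show 1: "y * u = x * v + 2"
    unfolding u_def v_def using det by (simp add: algebra_simps power2_eq_square)
  have "a * c = (y * u) * (x * v)" by (simp add: a_def c_def)
  also have "\<dots> = (b + 1) * (b - 1)" using 1 by (simp add: b_def)
  finally show "a * c = b\<^sup>2 - 1" by (simp add: algebra_simps power2_eq_square)
qed

text \<open>The pair \<open>(p, q)\<close> was found by computing the large partial quotients of \<open>\<sigma>\<^sup>2\<close>.\<close>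

lemma approx_cross: "q * a - p * c = t * x"
proof -
  have uw: "u * w = y * v - t"
  proof -
    have "t * (x * w) = t * (y\<^sup>2 - 1)" using det by simp
    then show ?thesis by (simp add: u_def v_def algebra_simps power2_eq_square)
  qed
  have "q * a = x * (b * (t * (y * u) + u * w))"
    by (simp add: q_def a_def algebra_simps)
  also have "\<dots> = x * (b * (t * (b + 1) + y * v - t))" using uw by (simp add: b_def)
  also have "\<dots> = x * (t * b\<^sup>2 + b * c)" by (simp add: c_def algebra_simps power2_eq_square)
  also have "\<dots> = x * (t * (a * c + 1) + b * c)" using double_det by simp
  also have "\<dots> = p * c + t * x" by (simp add: p_def algebra_simps)
  finally show ?thesis by simp
qed

text \<open>All large terms cancel at \<open>h = b / a\<close>, the value that the palindrome structure gives, to first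
  order, for the fractional part following the partial quotient \<open>2 * t\<close>.\<close>

lemma approx_numerator:
  assumes "x \<noteq> 0" "u \<noteq> 0"
  defines "d \<equiv> b / a"
  shows "q * (a * (2 * t + h) + b)\<^sup>2 - p * (b * (2 * t + h) + c)\<^sup>2 =
    (b + 2 - u\<^sup>2) / (x * u\<^sup>2) - x * b * (h - d) * (h + d + 2 * t)"
proof -
  define z where "z = 2 * t + h"
  define N where "N = (\<lambda>h. t * x * c + q - x * b * h\<^sup>2 - 2 * t * x * b * h)"
  have bb: "b\<^sup>2 = a * c + 1" using double_det by simp
  \<comment> \<open>Each coefficient of the quadratic in \<open>z\<close> reduces to the cross term
    \<open>q * a - p * c\<close> through \<open>a * c = b\<^sup>2 - 1\<close>. Here the choice of
    \<open>p\<close> also cancels \<open>t * x * a\<close>.\<close>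
  have e1: "q * a\<^sup>2 - p * b\<^sup>2 = - (x * b)"
  proof -
    have "q * a\<^sup>2 - p * b\<^sup>2 = a * (q * a - p * c) - p"
      unfolding bb by (simp add: algebra_simps power2_eq_square)
    then show ?thesis unfolding approx_cross by (simp add: p_def algebra_simps)
  qed
  have e2: "q * (a * b) - p * (b * c) = b * (t * x)"
  proof -
    have "q * (a * b) - p * (b * c) = b * (q * a - p * c)" by (simp add: algebra_simps)
    then show ?thesis unfolding approx_cross .
  qed
  have e3: "q * b\<^sup>2 - p * c\<^sup>2 = c * (t * x) + q"
  proof -
    have "q * b\<^sup>2 - p * c\<^sup>2 = c * (q * a - p * c) + q"
      unfolding bb by (simp add: algebra_simps power2_eq_square)
    then show ?thesis unfolding approx_cross .
  qed
  have "q * (a * z + b)\<^sup>2 - p * (b * z + c)\<^sup>2 =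
     (q * a\<^sup>2 - p * b\<^sup>2) * z\<^sup>2 + 2 * (q * (a * b) - p * (b * c)) * z + (q * b\<^sup>2 - p * c\<^sup>2)"
    by (simp add: algebra_simps power2_eq_square)
  also have "\<dots> = N h"
    unfolding e1 e2 e3 N_def z_def by (simp add: algebra_simps power2_eq_square)
  also have "\<dots> = N d - x * b * (h - d) * (h + d + 2 * t)"
    unfolding N_def by (simp add: algebra_simps power2_eq_square)
  also have "N d = (b + 2 - u\<^sup>2) / (x * u\<^sup>2)"
  proof -
    have xd: "x * u * d = b" using assms by (simp add: d_def a_def)
    have yu: "y * u = b + 1" by (simp add: b_def)
    have xv: "x * v = b - 1" using double_det yu by simp
    have txu: "t * x * u = u\<^sup>2 - 2 * (b + 1)"
      unfolding yu[symmetric] by (simp add: u_def algebra_simps power2_eq_square)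
    \<comment> \<open>After multiplication by \<open>x * u\<^sup>2\<close> everything is a
      polynomial in \<open>b\<close> and \<open>u\<close>, and all terms of higher degree
      cancel.\<close>
    have "N d * (x * u\<^sup>2) = (t * x * u) * (y * u) * (x * v) + b * ((t * x * u) * (y * u) + (x * w) * u\<^sup>2)
        - b * (x * u * d)\<^sup>2 - 2 * (t * x * u) * b * (x * u * d)"
      unfolding N_def q_def c_def by (simp add: algebra_simps power2_eq_square)
    also have "(x * w) * u\<^sup>2 = (y * u)\<^sup>2 - u\<^sup>2" unfolding det by (simp add: algebra_simps)
    also have "(t * x * u) * (y * u) * (x * v) + b * ((t * x * u) * (y * u) + ((y * u)\<^sup>2 - u\<^sup>2))
        - b * (x * u * d)\<^sup>2 - 2 * (t * x * u) * b * (x * u * d) = b + 2 - u\<^sup>2"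
      unfolding xd yu xv txu by (simp add: algebra_simps power2_eq_square)
    finally show ?thesis using assms by (simp add: field_simps)
  qed
  finally show ?thesis by (simp add: z_def)
qed

end

section \<open>Size of the error\<close>

text \<open>The error is at most \<open>(4 / x) / (q * b\<^sup>2)\<close>, while \<open>q\<close> is
  of order \<open>t\<^sup>2 * y ^ 3\<close>, so \<open>x * b\<^sup>2\<close> dominates
  \<open>q powr (5 / 3)\<close> up to powers of \<open>t\<close>. The form of \<open>z\<close> says
  that the palindrome recurs after the quotient \<open>2 * t\<close>, followed by
  \<open>s\<close>.\<close>

lemma square_approx:
  fixes x y w t s :: real
  assumes det: "x * w = y\<^sup>2 - 1"
    and bounds: "1 \<le> y" "y \<le> x" "x + 1 \<le> 2 * y" "0 \<le> w" "w \<le> y" "2 \<le> t" "1 \<le> s"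
  defines "u \<equiv> t * x + 2 * y" and "v \<equiv> t * y + 2 * w"
  defines "a \<equiv> x * u" and "b \<equiv> y * u - 1" and "c \<equiv> y * v"
  defines "p \<equiv> x * (t * a + b)" and "q \<equiv> b * (t * y + w)"
  defines "z \<equiv> 2 * t + 1 / ((a * s + b) / (b * s + c))"
  shows "\<bar>((a * z + b) / (b * z + c))\<^sup>2 - p / q\<bar> \<le> 256 * t ^ 4 * q powr (- (8 / 3))"
proof -
  note defs = u_def v_def a_def b_def c_def p_def q_def
  have yu: "y * u = x * v + 2" and ac: "a * c = b\<^sup>2 - 1"
    using double_det[OF det, of t] unfolding defs by simp_all
  have tx: "2 * x \<le> t * x" and ty: "2 * y \<le> t * y"
    using bounds by (auto intro!: mult_right_mono)
  have u: "4 * y \<le> u" "t * x \<le> u" using tx bounds unfolding u_def by linarith+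
  have v: "0 \<le> v" using ty bounds unfolding v_def by linarith
  have y2: "y \<le> y\<^sup>2" using bounds by (simp add: power2_eq_square)
  have b1: "y\<^sup>2 \<le> b"
  proof -
    have "y * (4 * y) \<le> y * u" using u bounds by (intro mult_left_mono) auto
    then have "4 * y\<^sup>2 \<le> y * u" by (simp add: power2_eq_square)
    then show ?thesis using y2 bounds(1) unfolding b_def by linarith
  qed
  then have b: "1 \<le> b" using y2 bounds by linarith
  have ba: "b \<le> a"
    using mult_right_mono[OF bounds(2), of u] u bounds unfolding a_def b_def by linarith
  have cb: "c \<le> b"
    using mult_right_mono[OF bounds(2), of v] v bounds yu unfolding b_def c_def by linarith
  have c: "0 \<le> c" using v bounds by (simp add: c_def)
  have tyw: "1 \<le> t * y + w" using ty bounds by linarith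
  have q: "b \<le> q"
    using mult_left_mono[OF tyw, of b] b unfolding q_def by simp
  have pos: "0 < x" "0 < y" "0 < u" "0 < a" "0 < b" "0 < q" "0 < t" "0 < s"
    using bounds u b ba q by linarith+
  have as: "a \<le> a * s" using pos bounds by simp
  \<comment> \<open>\<open>h\<close> is the fractional part of \<open>z\<close> when it is below 1,
    and \<open>d\<close> is its limit as \<open>s\<close> tends to infinity.\<close>
  define h where "h = (b * s + c) / (a * s + b)"
  define d where "d = b / a"
  have "0 < b * s" using pos by simp
  then have num: "0 < a * s + b" "0 < b * s + c" using as pos c by linarith+
  have z: "z = 2 * t + h" by (simp add: z_def h_def)
  have h: "0 \<le> h" "h \<le> 1"
  proof -
    have "b * s \<le> a * s" using mult_right_mono[OF ba, of s] pos by simp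
    then have "b * s + c \<le> a * s + b" using cb by linarith
    then show "h \<le> 1" using num by (simp add: h_def divide_le_eq)
  qed (use num in \<open>simp add: h_def\<close>)
  have d: "0 \<le> d" "d \<le> 1" using pos ba unfolding d_def by simp_all
  have hd: "h - d = - (1 / (a * (a * s + b)))"
  proof -
    have "(b * s + c) * a - b * (a * s + b) = - 1"
      using ac by (simp add: algebra_simps power2_eq_square)
    then have "h - d = - 1 / ((a * s + b) * a)"
      unfolding h_def d_def using num pos by (subst diff_frac_eq) simp_all
    then show ?thesis by (simp add: mult.commute)
  qed
  define N where "N = q * (a * z + b)\<^sup>2 - p * (b * z + c)\<^sup>2"
  have N: "N = (b + 2 - u\<^sup>2) / (x * u\<^sup>2) - x * b * (h - d) * (h + d + 2 * t)"
    unfolding N_def z d_def using approx_numerator[OF det, of t h] pos unfolding defs by simp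
  have "\<bar>(b + 2 - u\<^sup>2) / (x * u\<^sup>2)\<bar> \<le> 1 / x"
  proof -
    have "1 * u \<le> y * u" "4 * y * u \<le> u * u" using bounds u pos by (auto intro!: mult_right_mono)
    then have "b + 2 \<le> u\<^sup>2" using u bounds unfolding b_def power2_eq_square by linarith
    then have "\<bar>b + 2 - u\<^sup>2\<bar> \<le> u\<^sup>2" using pos by linarith
    then show ?thesis using pos by (simp add: abs_mult divide_le_eq)
  qed
  moreover have "\<bar>x * b * (h - d) * (h + d + 2 * t)\<bar> \<le> 3 / x"
  proof -
    have "\<bar>x * b * (h - d) * (h + d + 2 * t)\<bar> = x * b * (h + d + 2 * t) / (a * (a * s + b))"
      unfolding hd using pos h d num by (simp add: abs_mult)
    \<comment> \<open>Uses \<open>h + d + 2 * t \<le> 2 + 2 * t \<le> 3 * t\<close>, valid because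
      \<open>t\<close> is at least 2.\<close>
    also have "\<dots> \<le> x * a * (3 * t) / (a * a)"
    proof (intro frac_le mult_mono mult_left_mono)
      show "a \<le> a * s + b" using as pos by linarith
    qed (use pos h d ba bounds in auto)
    also have "\<dots> = 3 * t / u" using pos by (simp add: a_def)
    also have "\<dots> \<le> 3 * t / (t * x)" using pos u by (intro divide_left_mono) auto
    also have "\<dots> = 3 / x" using pos by simp
    finally show ?thesis .
  qed
  ultimately have "\<bar>N\<bar> \<le> 1 / x + 3 / x"
    unfolding N by (intro order_trans[OF abs_triangle_ineq4 add_mono])
  then have N_le: "\<bar>N\<bar> \<le> 4 / x" by (simp add: add_divide_distrib[symmetric])
  have den: "b \<le> b * z + c"
  proof -
    have "b * 1 \<le> b * z" using z h bounds pos by (intro mult_left_mono) auto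
    then show ?thesis using c by linarith
  qed
  have diff: "((a * z + b) / (b * z + c))\<^sup>2 - p / q = N / (q * (b * z + c)\<^sup>2)"
    unfolding N_def power_divide using pos den
    by (subst diff_frac_eq) (auto simp: mult.commute)
  have "\<bar>((a * z + b) / (b * z + c))\<^sup>2 - p / q\<bar> = \<bar>N\<bar> / (q * (b * z + c)\<^sup>2)"
    unfolding diff using pos by (simp add: abs_mult)
  also have "\<dots> \<le> (4 / x) / (q * b\<^sup>2)"
    using N_le pos den by (intro frac_le mult_left_mono power_mono) auto
  also have "\<dots> \<le> 256 * t ^ 4 * q powr (- (8 / 3))"
  proof -
    have "q \<le> 8 * t\<^sup>2 * y ^ 3"
    proof -
      have "t * x \<le> t * (2 * y)" using bounds by (intro mult_left_mono) auto
      then have "u \<le> 4 * (t * y)" using ty bounds unfolding u_def by linarith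
      then have "y * u \<le> y * (4 * (t * y))" using pos by (intro mult_left_mono) auto
      then have "b \<le> y * (4 * (t * y))" unfolding b_def by linarith
      moreover have "t * y + w \<le> 2 * (t * y)" using ty bounds by linarith
      ultimately have "q \<le> (y * (4 * (t * y))) * (2 * (t * y))"
        unfolding q_def using pos tyw by (intro mult_mono) auto
      then show ?thesis by (simp add: power2_eq_square power3_eq_cube mult_ac)
    qed
    then have "q powr (5 / 3) \<le> (8 * t\<^sup>2 * y ^ 3) powr (5 / 3)"
      using pos by (intro powr_mono2) auto
    also have "\<dots> = (8 * t\<^sup>2) powr (5 / 3) * (y ^ 3) powr (5 / 3)"
      using pos by (simp add: powr_mult)
    also have "(y ^ 3) powr (5 / 3) = y ^ 5"
      using powr_powr[of y 3 "5 / 3"] pos by simp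
    \<comment> \<open>Rounding the exponent up to 2 costs only a power of \<open>t\<close>, which is
      negligible against \<open>q\<close> in the end.\<close>
    also have "(8 * t\<^sup>2) powr (5 / 3) \<le> (8 * t\<^sup>2) powr 2"
    proof (intro powr_mono)
      have "1 \<le> t" using bounds by linarith
      then show "1 \<le> 8 * t\<^sup>2" using one_le_power[of t 2] by linarith
    qed simp
    also have "(8 * t\<^sup>2) powr 2 = 64 * t ^ 4"
      using pos by (simp add: power2_eq_square power4_eq_xxxx)
    also have "y ^ 5 \<le> x * b\<^sup>2"
    proof -
      have "y * (y\<^sup>2)\<^sup>2 \<le> x * b\<^sup>2" using bounds b1 pos by (intro mult_mono power_mono) auto
      then show ?thesis by (simp add: numeral_eq_Suc mult_ac)
    qed
    finally have q53: "q powr (5 / 3) \<le> 64 * t ^ 4 * (x * b\<^sup>2)"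
      using pos by (simp add: mult_left_mono mult_right_mono)
    \<comment> \<open>One factor \<open>q\<close> is split off to match the denominator
      \<open>q * b\<^sup>2\<close>; the constant 256 is 4 times 64.\<close>
    have "q powr (8 / 3) = q * q powr (5 / 3)"
      using pos powr_add[of q 1 "5 / 3"] by simp
    also have "\<dots> \<le> q * (64 * t ^ 4 * (x * b\<^sup>2))"
      using q53 pos by (intro mult_left_mono) auto
    finally have "4 * q powr (8 / 3) \<le> 256 * t ^ 4 * (x * (q * b\<^sup>2))" by (simp add: mult_ac)
    then show ?thesis
      using pos by (simp add: powr_minus field_simps)
  qed
  finally show ?thesis .
qed

section \<open>Rational approximations to the square of sigma\<close>

lemma sigma_square_approx:
  obtains p q :: int where "2 ^ (2 ^ m - 1) \<le> q"
    "\<bar>sigma\<^sup>2 - p / q\<bar> \<le> 256 * (2 ^ Suc m) ^ 4 * q powr (- (8 / 3))"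
proof -
  obtain x y w where xyw: "pal m = (x, y, w)" by (metis prod.exhaust)
  note inv = pal_invariants[OF xyw]
  define t :: int where "t = 2 ^ Suc m"
  define u where "u = t * x + 2 * y"
  define v where "v = t * y + 2 * w"
  define a where "a = x * u"
  define b where "b = y * u - 1"
  define c where "c = y * v"
  define p where "p = x * (t * a + b)"
  define q where "q = b * (t * y + w)"
  have abc: "pal (Suc m) = (a, b, c)"
    using xyw by (simp add: Let_def a_def b_def c_def u_def v_def t_def)
  note inv' = pal_invariants[OF abc]
  have t: "2 \<le> t" by (simp add: t_def)
  have rt: "real_of_int t = 2 ^ Suc m" by (simp add: t_def)
  let ?E = "256 * (2 ^ Suc m) ^ 4 * q powr (- (8 / 3))"
  \<comment> \<open>The word of \<open>pal (Suc m)\<close> has \<open>2 ^ Suc (Suc m) - 1\<close>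
    letters; one further doubling supplies the quotient \<open>2 * t\<close> and the second copy of
    the word. The bound is independent of \<open>k\<close> and so passes to the limit.\<close>
  have bound: "\<bar>(cfrac_conv sigma_quot k)\<^sup>2 - p / q\<bar> \<le> ?E"
    if k: "2 ^ Suc (Suc (Suc m)) - 1 \<le> k" for k
  proof -
    obtain s where s: "1 \<le> s"
        "cfrac_conv sigma_quot k = cfrac_tail sigma_quot (2 ^ Suc (Suc (Suc m)) - 1) s"
      by (rule cfrac_conv_sigma_quot_tail[OF k])
    have ab: "1 \<le> real_of_int a" "1 \<le> real_of_int b" "0 \<le> real_of_int c"
      using inv'(2,4,6) by simp_all
    define z where "z = 2 * real_of_int t + 1 / ((a * s + b) / (b * s + c))"
    have "0 < 1 / ((a * s + b) / (b * s + c))"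
      using ab s(1) by (intro divide_pos_pos add_pos_nonneg add_pos_pos mult_pos_pos) auto
    then have "0 < z" unfolding z_def using t by simp
    have "cfrac_conv sigma_quot k = cfrac_tail sigma_quot (2 ^ Suc (Suc m) - 1) z"
    proof -
      have "cfrac_tail sigma_quot (2 ^ Suc (Suc m) - 1) s = (a * s + b) / (b * s + c)"
        using s(1) by (intro cfrac_tail_pal[OF abc]) simp
      moreover have "2 * real_of_int t = 2 ^ Suc (Suc m)" by (simp add: rt)
      ultimately show ?thesis
        unfolding s(2) cfrac_tail_double[of "Suc (Suc m)"] z_def by (simp only:)
    qed
    also have "\<dots> = (a * z + b) / (b * z + c)" by (rule cfrac_tail_pal[OF abc \<open>0 < z\<close>])
    finally have conv: "cfrac_conv sigma_quot k = (a * z + b) / (b * z + c)" .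
    have "real_of_int x * real_of_int w = (real_of_int y)\<^sup>2 - 1"
      using arg_cong[OF inv(1), of real_of_int] by simp
    from square_approx[OF this, of t s]
    show ?thesis
      unfolding conv rt[symmetric] z_def using inv(2-6) t s(1)
      by (simp add: a_def b_def c_def p_def q_def u_def v_def)
  qed
  have "(\<lambda>k. \<bar>(cfrac_conv sigma_quot k)\<^sup>2 - p / q\<bar>) \<longlonglongrightarrow> \<bar>sigma\<^sup>2 - p / q\<bar>"
    by (intro tendsto_intros cfrac_conv_sigma_quot_LIMSEQ)
  then have "\<bar>sigma\<^sup>2 - p / q\<bar> \<le> ?E"
    by (rule LIMSEQ_le_const2) (use bound in blast)
  moreover have "2 ^ (2 ^ m - 1) \<le> q"
  proof -
    have "2 * y \<le> t * y" using t inv(6) by (intro mult_right_mono) auto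
    then have "y \<le> t * y + w" using inv(4,6) by linarith
    then have "1 * y \<le> b * (t * y + w)" using inv'(6) inv(6) by (intro mult_mono) auto
    then show ?thesis using inv(7) unfolding q_def by linarith
  qed
  ultimately show ?thesis using that by blast
qed

section \<open>The lower bound for the exponent\<close>

theorem theorem4: "irrationality_measure (sigma\<^sup>2) \<ge> ereal (8 / 3)"
  unfolding irrationality_measure_def
proof (rule Inf_greatest, safe)
  fix \<mu> :: real
  let ?S = "{(p :: int, q :: int). q \<ge> 1 \<and> \<bar>sigma\<^sup>2 - of_int p / of_int q\<bar> < of_int q powr (- \<mu>)}"
  assume fin: "finite ?S"
  have "8 / 3 \<le> \<mu>"
  proof (rule ccontr)
    define e where "e = 8 / 3 - \<mu>"
    assume "\<not> 8 / 3 \<le> \<mu>"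
    then have e: "e > 0" by (simp add: e_def)
    \<comment> \<open>Finitely many solutions have bounded denominators, so one solution with a
      larger \<open>q\<close> is a contradiction.\<close>
    have "bdd_above (snd ` ?S)" using fin by (intro bdd_above_finite finite_imageI)
    then obtain B where B: "\<And>p q. (p, q) \<in> ?S \<Longrightarrow> q \<le> B"
      unfolding bdd_above_def by (metis (no_types, lifting) image_eqI snd_conv)
    \<comment> \<open>Binary logarithms: \<open>12 + 4 * real m\<close> belongs to the factor
      \<open>256 * (2 ^ Suc m) ^ 4\<close>, and the right side to a lower bound for
      \<open>q powr e\<close>.\<close>
    have "eventually (\<lambda>m. 12 + 4 * real m < e * (2 ^ m - 1)) at_top"
      using e by real_asymp
    \<comment> \<open>This forces \<open>q > B\<close>, as \<open>q\<close> is at least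
      \<open>2 ^ (2 ^ m - 1)\<close> and hence exceeds \<open>m\<close>.\<close>
    moreover have "eventually (\<lambda>m. nat B < m) at_top" by (rule eventually_gt_at_top)
    ultimately have "eventually (\<lambda>m. 12 + 4 * real m < e * (2 ^ m - 1) \<and> nat B < m) at_top"
      by (rule eventually_conj)
    then obtain m where m: "12 + 4 * real m < e * (2 ^ m - 1)" "nat B < m"
      by (auto simp: eventually_at_top_linorder)
    obtain p q :: int where q: "2 ^ (2 ^ m - 1) \<le> q"
      and pq: "\<bar>sigma\<^sup>2 - p / q\<bar> \<le> 256 * (2 ^ Suc m) ^ 4 * q powr (- (8 / 3))"
      by (rule sigma_square_approx)
    have "(1::int) \<le> 2 ^ (2 ^ m - 1)" by simp
    then have q1: "1 \<le> q" using q by linarith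
    have r: "real (2 ^ m - 1) = 2 ^ m - 1" by (simp add: of_nat_diff)
    have "256 * (2 ^ Suc m) ^ 4 = 2 powr (12 + 4 * real m)"
      by (simp add: powr_add powr_realpow[symmetric] powr_powr mult.commute flip: power_mult)
    also have "\<dots> < 2 powr (e * (2 ^ m - 1))" using m(1) by simp
    also have "\<dots> = (2 ^ (2 ^ m - 1)) powr e"
      by (simp add: powr_powr r mult.commute flip: powr_realpow)
    also have "\<dots> \<le> q powr e"
    proof (rule powr_mono2)
      have "real_of_int (2 ^ (2 ^ m - 1)) \<le> q" using q by (simp only: of_int_le_iff)
      then show "2 ^ (2 ^ m - 1) \<le> real_of_int q" by simp
    qed (use e in auto)
    finally have "256 * (2 ^ Suc m) ^ 4 * q powr (- (8 / 3)) < q powr e * q powr (- (8 / 3))"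
      using q1 by (intro mult_strict_right_mono) auto
    also have "\<dots> = q powr (- \<mu>)" by (simp add: e_def flip: powr_add)
    finally have "(p, q) \<in> ?S" using pq q1 by simp
    then have "q \<le> B" by (rule B)
    moreover have "m \<le> 2 ^ m - 1" using less_exp[of m] by linarith
    then have "m < 2 ^ (2 ^ m - 1)" using less_exp[of "2 ^ m - 1"] by linarith
    then have "int m < 2 ^ (2 ^ m - 1)" by (metis of_nat_less_iff of_nat_power of_nat_numeral)
    ultimately show False using q m(2) by linarith
  qed
  then show "ereal (8 / 3) \<le> ereal \<mu>" by simp
qed

end
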